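(* Let $W\subseteq\mathbb{R}^2$ be a finite set of points, $V\subseteq W$ a set of $n$ points, and $C_1,\dots,C_m$ distinct convex hulls of subsets of $V$ such that $|C_i\cap C_j\cap W|=1$ for all $i\ne j$. Suppose moreover that whenever $i\ne j$ and both $C_i$ and $C_j$ are $2$-dimensional, the vertex sets (sets of extreme points) of $C_i$ and $C_j$ are disjoint. Then $m\le n$. *)

theory Defs
  imports "HOL-Analysis.Analysis"
begin

definition vertex_set :: "(real^2) set \<Rightarrow> (real^2) set" where
  "vertex_set K = {x. x extreme_point_of K}"

end

theory Submission
  imports Defs
begin

text \<open>
  Each hull is assigned one of its vertices, injectively. If all hulls share a point of \<open>W\<close>,
  send each hull to a vertex other than that point. Otherwise a segment with endpoints \<open>v\<close> and \<open>q\<close>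
  owns \<open>v\<close> unless some hull through \<open>v\<close> lies, apart from \<open>v\<close>, strictly to the right of the
  ray from \<open>v\<close> to \<open>q\<close>; a segment blocked at both ends would be blocked by two disjoint hulls. A polygon
  owns its vertex \<open>v\<close> if it lies, apart from \<open>v\<close>, strictly to the right of every segment leaving \<open>v\<close>. If a
  polygon owned none of its vertices, choose at each vertex a segment with a further vertex
  on its left. These segments meet pairwise outside the polygon, which makes
  ``lies to the left of the segment chosen at'' a strict linear order on the vertices, without
  a maximal element.
\<close>

section \<open>Orientation of point triples in the plane\<close>

text \<open>Twice the signed area of the triangle \<open>a b c\<close>: positive when
  \<open>c\<close> is left of the ray from \<open>a\<close> to \<open>b\<close>, negative when
  right.\<close>

definition orient :: "real^2 \<Rightarrow> real^2 \<Rightarrow> real^2 \<Rightarrow> real" where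
  "orient a b c = (b$1 - a$1) * (c$2 - a$2) - (b$2 - a$2) * (c$1 - a$1)"

lemma orient_degenerate [simp]: "orient a b a = 0" "orient a b b = 0"
  by (simp_all add: orient_def)

lemma orient_swap: "orient a b c = - orient b a c" "orient a b c = - orient a c b"
  by (simp_all add: orient_def algebra_simps)

lemma orient_rotate: "orient a b c = orient b c a"
  by (simp add: orient_def algebra_simps)

lemma orient_convex_comb:
  assumes "u + v = 1"
  shows "orient a b (u *\<^sub>R x + v *\<^sub>R y) = u * orient a b x + v * orient a b y"
proof -
  have u: "u = 1 - v" using assms by simp
  show ?thesis unfolding u by (simp add: orient_def algebra_simps)
qed

lemma orient_eq_0_imp_between:
  assumes "orient a b c = 0"
  shows "a \<in> closed_segment b c \<or> b \<in> closed_segment c a \<or> c \<in> closed_segment a b"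
proof (cases "a = b")
  case False
  define d where "d = b - a"
  \<comment> \<open>Coefficient of the orthogonal projection of \<open>c - a\<close> onto
    \<open>d\<close>; by collinearity the projection is \<open>c - a\<close> itself.\<close>
  define t where "t = ((c$1 - a$1) * d$1 + (c$2 - a$2) * d$2) / ((d$1)\<^sup>2 + (d$2)\<^sup>2)"
  have "d \<noteq> 0" using False by (simp add: d_def)
  then have pos: "(d$1)\<^sup>2 + (d$2)\<^sup>2 \<noteq> 0"
    by (auto simp: vec_eq_iff forall_2 sum_power2_eq_zero_iff)
  have eq: "d$1 * (c$2 - a$2) = d$2 * (c$1 - a$1)"
    using assms by (simp add: orient_def d_def)
  have "(c$1 - a$1) * ((d$1)\<^sup>2 + (d$2)\<^sup>2) = ((c$1 - a$1) * d$1 + (c$2 - a$2) * d$2) * d$1"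
    "(c$2 - a$2) * ((d$1)\<^sup>2 + (d$2)\<^sup>2) = ((c$1 - a$1) * d$1 + (c$2 - a$2) * d$2) * d$2"
    using eq by algebra+
  then have "c$1 - a$1 = t * d$1" "c$2 - a$2 = t * d$2"
    using pos by (simp_all add: t_def field_simps)
  then have "c - a = t *\<^sub>R d"
    by (simp add: vec_eq_iff forall_2)
  then have "collinear {0, b - a, c - a}"
    by (metis collinear_lemma d_def)
  then have "collinear {a, b, c}"
    using collinear_3[of b a c] by (simp add: insert_commute)
  then show ?thesis
    by (simp add: collinear_between_cases between_mem_segment)
qed simp

lemma orient_segment:
  assumes "x \<in> closed_segment a b"
  obtains t where "0 \<le> t" "t \<le> 1" "x = a + t *\<^sub>R (b - a)" "\<And>c. orient a x c = t * orient a b c"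
proof -
  obtain t where t: "0 \<le> t" "t \<le> 1" "x = (1 - t) *\<^sub>R a + t *\<^sub>R b"
    using assms by (auto simp: closed_segment_def)
  have "orient a x c = t * orient a b c" for c
    by (simp add: t(3) orient_def algebra_simps)
  moreover have "x = a + t *\<^sub>R (b - a)" by (simp add: t(3) algebra_simps)
  ultimately show ?thesis using t that by blast
qed

text \<open>A convex combination of nonpositive orientations vanishes only if every point of
  positive weight is \<open>a\<close>. Hence being strictly right apart from \<open>a\<close> need
  only be tested on vertices.\<close>

lemma convex_insert_right_of: "convex (insert a {x. orient a b x < 0})"
proof (rule convexI)
  fix x y and u v :: real
  assume xy: "x \<in> insert a {x. orient a b x < 0}" "y \<in> insert a {x. orient a b x < 0}"
    and uv: "0 \<le> u" "0 \<le> v" "u + v = 1"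
  let ?z = "u *\<^sub>R x + v *\<^sub>R y"
  have nonpos: "orient a b x \<le> 0" "orient a b y \<le> 0" using xy by auto
  then have le: "u * orient a b x \<le> 0" "v * orient a b y \<le> 0"
    using uv by (simp_all add: mult_nonneg_nonpos)
  show "?z \<in> insert a {x. orient a b x < 0}"
  proof (cases "orient a b ?z < 0")
    case False
    then have "u * orient a b x = 0" "v * orient a b y = 0"
      using le orient_convex_comb[OF uv(3), of a b x y] by linarith+
    then have "u = 0 \<or> x = a" "v = 0 \<or> y = a" using xy by auto
    then have "?z = a" using uv(3)
      by (auto simp flip: scaleR_left_distrib)
    then show ?thesis by simp
  qed simp
qed

text \<open>The three orientations divided by their sum \<open>D\<close> are the barycentric
  coordinates of \<open>x\<close>; equal signs make them nonnegative.\<close>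

lemma in_triangle_if_orient_neg:
  assumes "orient x p q < 0" "orient x q r < 0" "orient x r p < 0"
  shows "x \<in> convex hull {p, q, r}"
proof -
  define D where "D = orient p q r"
  have D: "D = orient x q r + orient x r p + orient x p q"
    by (simp add: D_def orient_def algebra_simps)
  then have "D < 0" using assms by simp
  define a b c where "a = orient x q r / D" and "b = orient x r p / D" and "c = orient x p q / D"
  have "0 \<le> a" "0 \<le> b" "0 \<le> c"
    using assms \<open>D < 0\<close> by (simp_all add: a_def b_def c_def divide_nonpos_neg)
  moreover have sum: "a + b + c = 1"
    using D \<open>D < 0\<close> by (simp add: a_def b_def c_def add_divide_distrib[symmetric])
  moreover have "x = a *\<^sub>R p + b *\<^sub>R q + c *\<^sub>R r"
  proof -
    have "D * x$i = orient x q r * p$i + orient x r p * q$i + orient x p q * r$i"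
      if "i = 1 \<or> i = 2" for i
      using that by (auto simp: D_def orient_def algebra_simps)
    then have "x$i = a * p$i + b * q$i + c * r$i" if "i = 1 \<or> i = 2" for i
      using that \<open>D < 0\<close> by (auto simp: a_def b_def c_def field_simps)
    then show ?thesis by (simp add: vec_eq_iff forall_2)
  qed
  ultimately show ?thesis unfolding convex_hull_3 by blast
qed

section \<open>Hulls pairwise sharing one point of \<open>W\<close>\<close>

locale one_point_hulls =
  fixes W V :: "(real^2) set" and C :: "'i \<Rightarrow> (real^2) set" and I :: "'i set"
  assumes finite_W: "finite W" and V_subset: "V \<subseteq> W"
    and hull: "i \<in> I \<Longrightarrow> \<exists>S\<subseteq>V. C i = convex hull S"
    and nonempty: "i \<in> I \<Longrightarrow> C i \<noteq> {}"
    and inj: "inj_on C I"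
    and meet: "i \<in> I \<Longrightarrow> j \<in> I \<Longrightarrow> i \<noteq> j \<Longrightarrow> card (C i \<inter> C j \<inter> W) = 1"
    and polygons: "i \<in> I \<Longrightarrow> j \<in> I \<Longrightarrow> i \<noteq> j \<Longrightarrow> aff_dim (C i) = 2 \<Longrightarrow> aff_dim (C j) = 2
      \<Longrightarrow> vertex_set (C i) \<inter> vertex_set (C j) = {}"
begin

lemma meetE:
  assumes "i \<in> I" "j \<in> I" "i \<noteq> j"
  obtains x where "x \<in> C i" "x \<in> C j" "x \<in> W"
  using card_1_singletonE[OF meet[OF assms]] by blast

lemma meet_unique:
  assumes "i \<in> I" "j \<in> I" "i \<noteq> j" "x \<in> C i" "x \<in> C j" "x \<in> W" "y \<in> C i" "y \<in> C j" "y \<in> W"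
  shows "x = y"
proof -
  obtain z where "C i \<inter> C j \<inter> W = {z}"
    using card_1_singletonE[OF meet[OF assms(1-3)]] by blast
  then have "x \<in> {z}" "y \<in> {z}" using assms(4-9) by blast+
  then show ?thesis by simp
qed

lemma convex_C: "i \<in> I \<Longrightarrow> convex (C i)"
  using hull[of i] by auto

lemma compact_C: "i \<in> I \<Longrightarrow> compact (C i)"
  using hull[of i] finite_W V_subset
  by (metis finite_imp_compact_convex_hull finite_subset)

lemma vertex_set_subset:
  assumes "i \<in> I"
  shows "vertex_set (C i) \<subseteq> V" "vertex_set (C i) \<subseteq> C i"
proof -
  obtain S where "S \<subseteq> V" "C i = convex hull S" using hull[OF assms] by blast
  then show "vertex_set (C i) \<subseteq> V"
    using extreme_point_of_convex_hull by (auto simp: vertex_set_def)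
  show "vertex_set (C i) \<subseteq> C i" by (auto simp: vertex_set_def extreme_point_of_def)
qed

lemma C_eq_hull_vertex_set: "i \<in> I \<Longrightarrow> C i = convex hull vertex_set (C i)"
  unfolding vertex_set_def by (intro Krein_Milman_Minkowski compact_C convex_C)

lemma finite_V: "finite V"
  using finite_W V_subset by (rule finite_subset[rotated])

text \<open>Two hulls sharing their chosen vertex share it and \<open>p\<close>, so the vertex is
  \<open>p\<close>. Then both hulls are \<open>{p}\<close>, against injectivity.\<close>

lemma card_le_if_common_point:
  assumes "p \<in> W" "\<And>i. i \<in> I \<Longrightarrow> p \<in> C i"
  shows "card I \<le> card V"
proof -
  have "\<exists>v\<in>vertex_set (C i). C i \<noteq> {p} \<longrightarrow> v \<noteq> p" if "i \<in> I" for i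
  proof (rule ccontr)
    assume *: "\<not> ?thesis"
    have "vertex_set (C i) \<noteq> {}"
      using C_eq_hull_vertex_set[OF that] nonempty[OF that] by auto
    with * have "C i \<noteq> {p}" "vertex_set (C i) = {p}" by auto
    then show False using C_eq_hull_vertex_set[OF that] by simp
  qed
  then obtain f where f: "\<And>i. i \<in> I \<Longrightarrow> f i \<in> vertex_set (C i)"
      "\<And>i. i \<in> I \<Longrightarrow> C i \<noteq> {p} \<Longrightarrow> f i \<noteq> p"
    by metis
  have "inj_on f I"
  proof (rule inj_onI, rule ccontr)
    fix i j assume ij: "i \<in> I" "j \<in> I" "f i = f j" "i \<noteq> j"
    have "f i = p"
      using ij assms f(1)[OF ij(1)] f(1)[OF ij(2)] vertex_set_subset[OF ij(1)]
        vertex_set_subset[OF ij(2)] V_subset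
      by (intro meet_unique[OF ij(1,2,4)]) auto
    then have "C i = C j" using f(2) ij by metis
    then show False using inj ij by (auto dest: inj_onD)
  qed
  moreover have "f ` I \<subseteq> V" using f(1) vertex_set_subset by blast
  ultimately show ?thesis using finite_V by (rule card_inj_on_le)
qed

lemma segment_or_polygon:
  assumes "i \<in> I"
  obtains p q where "C i = closed_segment p q" "p \<in> V" "q \<in> V" | "aff_dim (C i) = 2"
proof (cases "aff_dim (C i) = 2")
  case False
  then have "collinear (C i)"
    using aff_dim_le_DIM[of "C i"] by (simp add: collinear_aff_dim)
  then obtain p q where pq: "C i = closed_segment p q"
    using compact_convex_collinear_segment[OF nonempty[OF assms] compact_C[OF assms] convex_C[OF assms]]
    by blast
  then have "p \<in> vertex_set (C i)" "q \<in> vertex_set (C i)"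
    by (simp_all add: vertex_set_def extreme_point_of_segment)
  then show ?thesis using that(1) pq vertex_set_subset(1)[OF assms] by blast
qed (use that in blast)

text \<open>\<open>C k\<close> meets both segments, hence contains points on either side of
  \<open>v\<close> (or \<open>v\<close> itself); convexity does the rest.\<close>

lemma opposite_segments_common_point:
  assumes "i \<in> I" "j \<in> I" "C i = closed_segment v q" "C j = closed_segment v r"
    and "v \<in> closed_segment q r" "v \<in> W" "k \<in> I"
  shows "v \<in> C k"
proof (cases "k = i \<or> k = j")
  case True
  then show ?thesis using assms by auto
next
  case False
  obtain x where x: "x \<in> C k" "x \<in> closed_segment v q" using meetE[of k i] assms False by metis
  obtain y where y: "y \<in> C k" "y \<in> closed_segment v r" using meetE[of k j] assms False by metis
  have "v \<in> closed_segment x y"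
  proof -
    \<comment> \<open>Along the line the order is \<open>q\<close>, \<open>x\<close>,
      \<open>v\<close>, \<open>y\<close>, \<open>r\<close>.\<close>
    have "between (q, r) v" "between (v, q) x" "between (v, r) y"
      using assms(5) x y by (simp_all add: between_mem_segment)
    then have "between (q, y) v"
      using between_trans_2[of r q v y] by (simp add: between_commute)
    then have "between (y, x) v"
      using between_trans_2[of q y v x] \<open>between (v, q) x\<close> by simp
    then show ?thesis by (simp add: between_mem_segment closed_segment_commute)
  qed
  then show ?thesis using closed_segment_subset[OF x(1) y(1) convex_C[OF assms(7)]] by blast
qed

section \<open>Blocking and ownership of vertices\<close>

text \<open>\<open>C j \<noteq> {v}\<close> keeps a one-point hull from blocking vacuously.\<close>

definition blocked :: "real^2 \<Rightarrow> real^2 \<Rightarrow> bool" where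
  "blocked v q \<longleftrightarrow> (\<exists>j\<in>I. v \<in> C j \<and> C j \<noteq> {v} \<and> (\<forall>x\<in>C j - {v}. orient v q x < 0))"

text \<open>The clauses exclude each other at \<open>v\<close>: a polygon satisfying the second one
  blocks every segment leaving \<open>v\<close>.\<close>

definition owns :: "'i \<Rightarrow> real^2 \<Rightarrow> bool" where
  "owns i v \<longleftrightarrow>
    (\<exists>q. q \<noteq> v \<and> C i = closed_segment v q \<and> \<not> blocked v q) \<or>
    (aff_dim (C i) = 2 \<and> v \<in> vertex_set (C i) \<and>
      (\<forall>j\<in>I. \<forall>q. q \<noteq> v \<longrightarrow> C j = closed_segment v q \<longrightarrow> (\<forall>x\<in>C i - {v}. orient v q x < 0)))"

text \<open>The blocker at \<open>p\<close> avoids \<open>q\<close> and vice versa, so a common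
  point of the two would lie strictly on both sides of the line.\<close>

lemma not_blocked_both:
  assumes "p \<noteq> q"
  shows "\<not> (blocked p q \<and> blocked q p)"
proof
  assume "blocked p q \<and> blocked q p"
  then obtain j k where j: "j \<in> I" "p \<in> C j" "\<And>x. x \<in> C j \<Longrightarrow> x \<noteq> p \<Longrightarrow> orient p q x < 0"
    and k: "k \<in> I" "q \<in> C k" "\<And>x. x \<in> C k \<Longrightarrow> x \<noteq> q \<Longrightarrow> orient q p x < 0"
    unfolding blocked_def by blast
  have q: "q \<notin> C j" and p: "p \<notin> C k" using j(3)[of q] k(3)[of p] assms by auto
  then have "j \<noteq> k" using k(2) by blast
  then obtain z where z: "z \<in> C j" "z \<in> C k" using meetE j(1) k(1) by metis
  then have "orient p q z < 0" "orient q p z < 0" using j(3) k(3) p q by metis+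
  then show False using orient_swap(1)[of p q z] by simp
qed

lemma polygon_owns_vertex:
  assumes i: "i \<in> I" "aff_dim (C i) = 2"
  shows "\<exists>v. owns i v"
proof (rule ccontr)
  assume no: "\<nexists>v. owns i v"
  let ?P = "vertex_set (C i)"
  have fin: "finite ?P" using vertex_set_subset(1)[OF i(1)] finite_V finite_subset by blast
  have ne: "?P \<noteq> {}" using C_eq_hull_vertex_set[OF i(1)] nonempty[OF i(1)] by auto
  have PW: "p \<in> C i" "p \<in> W" if "p \<in> ?P" for p
    using that vertex_set_subset[OF i(1)] V_subset by auto
  have "\<exists>j q p'. j \<in> I \<and> q \<noteq> p \<and> C j = closed_segment p q \<and> p' \<in> ?P \<and> p' \<noteq> p \<and> orient p q p' \<ge> 0"
    if p: "p \<in> ?P" for p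
  proof -
    obtain j q x where jq: "j \<in> I" "q \<noteq> p" "C j = closed_segment p q"
      and x: "x \<in> C i" "x \<noteq> p" "\<not> orient p q x < 0"
      using no i(2) p unfolding owns_def by blast
    \<comment> \<open>The witness \<open>x\<close> may not be a vertex, but if all other vertices
      were strictly right, so would be the whole polygon apart from \<open>p\<close>.\<close>
    have "\<not> ?P \<subseteq> insert p {x. orient p q x < 0}"
    proof
      assume "?P \<subseteq> insert p {x. orient p q x < 0}"
      then have "convex hull ?P \<subseteq> insert p {x. orient p q x < 0}"
        by (intro hull_minimal convex_insert_right_of)
      then show False using x C_eq_hull_vertex_set[OF i(1)] by auto
    qed
    then obtain p' where "p' \<in> ?P" "p' \<noteq> p" "\<not> orient p q p' < 0" by auto
    then show ?thesis using jq by (metis not_less)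
  qed
  then obtain J Q N where "\<forall>p\<in>?P. J p \<in> I \<and> Q p \<noteq> p \<and> C (J p) = closed_segment p (Q p) \<and>
      N p \<in> ?P \<and> N p \<noteq> p \<and> orient p (Q p) (N p) \<ge> 0"
    by metis
  then have J: "\<And>p. p \<in> ?P \<Longrightarrow> J p \<in> I"
    and Q: "\<And>p. p \<in> ?P \<Longrightarrow> Q p \<noteq> p" "\<And>p. p \<in> ?P \<Longrightarrow> C (J p) = closed_segment p (Q p)"
    and N: "\<And>p. p \<in> ?P \<Longrightarrow> N p \<in> ?P" "\<And>p. p \<in> ?P \<Longrightarrow> N p \<noteq> p"
           "\<And>p. p \<in> ?P \<Longrightarrow> orient p (Q p) (N p) \<ge> 0"
    by blast+
  have Ji: "J p \<noteq> i" if "p \<in> ?P" for p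
  proof
    assume "J p = i"
    then have "aff_dim (closed_segment p (Q p)) = 2" using Q(2)[OF that] i by simp
    moreover have "aff_dim (closed_segment p (Q p)) \<le> 1"
      using collinear_closed_segment collinear_aff_dim by blast
    ultimately show False by simp
  qed
  have only: "x = p" if "p \<in> ?P" "x \<in> C i" "x \<in> closed_segment p (Q p)" "x \<in> W" for x p
    using meet_unique[OF i(1) J[OF that(1)] Ji[OF that(1), symmetric]] that PW[OF that(1)] Q(2) by simp
  \<comment> \<open>The chosen segments share a point of \<open>W\<close>; inside the polygon it
    would equal both \<open>p\<close> and \<open>p'\<close>.\<close>
  have cross: "\<exists>x. x \<notin> C i \<and> x \<in> closed_segment p (Q p) \<and> x \<in> closed_segment p' (Q p')"
    if p: "p \<in> ?P" "p' \<in> ?P" "p \<noteq> p'" for p p'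
  proof -
    have "J p \<noteq> J p'"
      using only[OF p(1) PW(1)[OF p(2)] _ PW(2)[OF p(2)]] Q(2) p by (metis ends_in_segment(1))
    then obtain x where "x \<in> C (J p)" "x \<in> C (J p')" "x \<in> W" using meetE J p by metis
    then show ?thesis using only[OF p(1)] only[OF p(2)] Q(2) p by metis
  qed
  \<comment> \<open>Replacing \<open>Q p\<close> by a point of the segment outside
    \<open>C i\<close> keeps all signs: the factor is nonzero since \<open>p\<close> lies in
    \<open>C i\<close>.\<close>
  have scale: "\<exists>t>0. \<forall>c. orient p x c = t * orient p (Q p) c"
    if x: "p \<in> ?P" "x \<notin> C i" "x \<in> closed_segment p (Q p)" for p x
  proof -
    obtain t where t: "0 \<le> t" "x = p + t *\<^sub>R (Q p - p)" "\<And>c. orient p x c = t * orient p (Q p) c"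
      using orient_segment[OF x(3)] by metis
    then have "t \<noteq> 0" using x PW(1) by auto
    then show ?thesis using t by (metis less_le)
  qed
  define R where "R p p' \<longleftrightarrow> orient p (Q p) p' > 0" for p p'
  have R_iff: "R p p' \<longleftrightarrow> orient p x p' > 0"
    if "p \<in> ?P" "x \<notin> C i" "x \<in> closed_segment p (Q p)" for p p' x
    using scale[OF that] unfolding R_def by (auto simp: zero_less_mult_iff)
  have no_tie: "orient p (Q p) p' \<noteq> 0" if p: "p \<in> ?P" "p' \<in> ?P" "p \<noteq> p'" for p p'
  proof
    assume 0: "orient p (Q p) p' = 0"
    obtain x where x: "x \<notin> C i" "x \<in> closed_segment p (Q p)" "x \<in> closed_segment p' (Q p')"
      using cross[OF p] by blast
    have "orient p x p' = 0" using scale[OF p(1) x(1,2)] 0 by auto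
    \<comment> \<open>The outer cases put one vertex on the segment chosen at the other; the middle
      one puts \<open>x\<close> into the polygon.\<close>
    then consider "p \<in> closed_segment x p'" | "x \<in> closed_segment p' p" | "p' \<in> closed_segment p x"
      using orient_eq_0_imp_between by blast
    then show False
    proof cases
      case 1
      then have "p \<in> closed_segment p' x" by (simp add: closed_segment_commute)
      moreover have "closed_segment p' x \<subseteq> closed_segment p' (Q p')"
        using x(3) by (simp add: subset_closed_segment)
      ultimately have "p \<in> closed_segment p' (Q p')" by blast
      then show False using only[OF p(2)] PW[OF p(1)] p(3) by blast
    next
      case 2
      then show False
        using closed_segment_subset[OF PW(1)[OF p(2)] PW(1)[OF p(1)] convex_C[OF i(1)]] x(1) by blast
    next
      case 3
      moreover have "closed_segment p x \<subseteq> closed_segment p (Q p)"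
        using x(2) by (simp add: subset_closed_segment)
      ultimately have "p' \<in> closed_segment p (Q p)" by blast
      then show False using only[OF p(1)] PW[OF p(2)] p(3) by blast
    qed
  qed
  \<comment> \<open>From the common crossing point \<open>x\<close>, exchanging \<open>p\<close> and
    \<open>p'\<close> just flips the sign.\<close>
  have asym: "R p' p \<longleftrightarrow> \<not> R p p'" if p: "p \<in> ?P" "p' \<in> ?P" "p \<noteq> p'" for p p'
  proof -
    obtain x where x: "x \<notin> C i" "x \<in> closed_segment p (Q p)" "x \<in> closed_segment p' (Q p')"
      using cross[OF p] by blast
    have "orient p x p' \<noteq> 0" using scale[OF p(1) x(1,2)] no_tie[OF p] by auto
    moreover have "orient p' x p = - orient p x p'"
      by (simp add: orient_def algebra_simps)
    ultimately show ?thesis using R_iff[OF p(1) x(1,2)] R_iff[OF p(2) x(1,3)] by auto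
  qed
  have irrefl: "\<not> R p p" for p by (simp add: R_def)
  have trans: "R p r" if pqr: "p \<in> ?P" "q \<in> ?P" "r \<in> ?P" "R p q" "R q r" for p q r
  proof (rule ccontr)
    assume "\<not> R p r"
    have neq: "p \<noteq> q" "q \<noteq> r" "p \<noteq> r" using pqr irrefl asym by metis+
    \<comment> \<open>If \<open>r\<close> is not left of the segment at \<open>p\<close>, then
      \<open>p\<close>, \<open>q\<close>, \<open>r\<close> run clockwise around this crossing point,
      which places it in their triangle and so in the polygon.\<close>
    obtain x where x: "x \<notin> C i" "x \<in> closed_segment p (Q p)" "x \<in> closed_segment q (Q q)"
      using cross pqr neq by blast
    obtain t where t: "t > 0" "\<And>c. orient p x c = t * orient p (Q p) c"
      using scale[OF pqr(1) x(1,2)] by blast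
    have "orient p (Q p) r < 0"
      using \<open>\<not> R p r\<close> no_tie[OF pqr(1,3) neq(3)] by (simp add: R_def)
    then have "orient p x r < 0" using t by (simp add: mult_pos_neg)
    moreover have "orient p x q > 0" "orient q x r > 0"
      using R_iff x pqr by blast+
    ultimately have "orient x p q < 0" "orient x q r < 0" "orient x r p < 0"
      using orient_swap(1)[of x p q] orient_swap(1)[of x q r] orient_rotate[of p x r] by linarith+
    then have "x \<in> convex hull {p, q, r}" by (rule in_triangle_if_orient_neg)
    moreover have "convex hull {p, q, r} \<subseteq> C i"
      using pqr PW(1) by (intro hull_minimal convex_C[OF i(1)]) auto
    ultimately show False using x(1) by blast
  qed
  have "\<exists>p\<in>?P. \<forall>p'\<in>?P. p' \<noteq> p \<longrightarrow> \<not> R p p'"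
  proof (rule Finite_Set.bex_max_element[OF fin _ _ ne])
    show "asymp_on ?P R" by (rule asymp_onI) (metis irrefl asym)
    show "transp_on ?P R" by (rule transp_onI) (rule trans)
  qed
  then obtain p where p: "p \<in> ?P" "\<And>p'. p' \<in> ?P \<Longrightarrow> p' \<noteq> p \<Longrightarrow> \<not> R p p'" by blast
  \<comment> \<open>Without ties the weak inequality for \<open>N p\<close> is strict, so
    \<open>N p\<close> lies above the maximal \<open>p\<close>.\<close>
  have "orient p (Q p) (N p) > 0"
    using N[OF p(1)] no_tie[of p "N p"] p(1) by (metis less_le)
  then show False using p N unfolding R_def by blast
qed

section \<open>Injectivity of the assignment of owned vertices\<close>

lemma card_le: "card I \<le> card V"
proof (cases "\<exists>p\<in>W. \<forall>i\<in>I. p \<in> C i")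
  case True
  then show ?thesis using card_le_if_common_point by blast
next
  case False
  \<comment> \<open>Every other hull meets \<open>{p}\<close>, so \<open>p\<close> would be common
    to all hulls.\<close>
  have not_single: "C i \<noteq> {p}" if "i \<in> I" "p \<in> V" for i p
  proof
    assume p: "C i = {p}"
    have "p \<in> C j" if "j \<in> I" for j
    proof (cases "j = i")
      case False
      then show ?thesis using meetE[OF that \<open>i \<in> I\<close>] p by auto
    qed (use p in simp)
    then show False using False \<open>p \<in> V\<close> V_subset by blast
  qed
  have "\<exists>v\<in>V. owns i v" if i: "i \<in> I" for i
  proof (cases rule: segment_or_polygon[OF i])
    case (1 p q)
    then have "p \<noteq> q" using not_single[OF i 1(2)] by auto
    then have "owns i p \<or> owns i q"
      using not_blocked_both[of p q] 1(1) unfolding owns_def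
      by (metis closed_segment_commute)
    then show ?thesis using 1 by blast
  next
    case 2
    then obtain v where "owns i v" using polygon_owns_vertex i by blast
    moreover have "v \<in> vertex_set (C i)"
      using \<open>owns i v\<close> unfolding owns_def
      by (auto simp: vertex_set_def extreme_point_of_segment)
    ultimately show ?thesis using vertex_set_subset(1)[OF i] by blast
  qed
  then obtain f where f: "\<And>i. i \<in> I \<Longrightarrow> f i \<in> V" "\<And>i. i \<in> I \<Longrightarrow> owns i (f i)"
    by metis
  have seg_seg: False
    if ij: "i \<in> I" "j \<in> I" "i \<noteq> j" "v \<in> V" and q: "q \<noteq> v" "C i = closed_segment v q" "\<not> blocked v q"
      and r: "r \<noteq> v" "C j = closed_segment v r" "\<not> blocked v r" for i j v q r
  proof -
    have right: "blocked v a"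
      if "k \<in> I" "b \<noteq> v" "C k = closed_segment v b" "orient v a b < 0" for a b k
    proof -
      have "closed_segment v b \<subseteq> insert v {x. orient v a x < 0}"
        using that(4) by (intro closed_segment_subset convex_insert_right_of) auto
      moreover have "closed_segment v b \<noteq> {v}" using that(2) by auto
      ultimately show ?thesis unfolding blocked_def using that(1,3) by (auto intro!: bexI[of _ k])
    qed
    have endpoint: "b \<in> V" if "k \<in> I" "C k = closed_segment v b" for k b
      using vertex_set_subset(1)[OF that(1)] that(2)
      by (auto simp: vertex_set_def extreme_point_of_segment)
    \<comment> \<open>For either strict sign, one segment is strictly right of the other and blocks
      it.\<close>
    have "orient v q r = 0"
      using right[OF ij(2) r(1,2), of q] right[OF ij(1) q(1,2), of r] q(3) r(3) orient_swap(2)[of v q r]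
      by linarith
    \<comment> \<open>Opposite segments would make \<open>v\<close> common to all hulls; for nested
      ones the inner endpoint is a second common point in \<open>W\<close>.\<close>
    then consider "v \<in> closed_segment q r" | "q \<in> closed_segment r v" | "r \<in> closed_segment v q"
      using orient_eq_0_imp_between by blast
    then show False
    proof cases
      case 1
      then show False
        using opposite_segments_common_point[OF ij(1,2) q(2) r(2)] ij(4) V_subset False by blast
    next
      case 2
      then have "q = v"
        using q r ij endpoint[OF ij(1) q(2)] V_subset
        by (intro meet_unique[OF ij(1-3)]) (auto simp: closed_segment_commute)
      then show False using q by simp
    next
      case 3
      then have "r = v"
        using q r ij endpoint[OF ij(2) r(2)] V_subset
        by (intro meet_unique[OF ij(1-3)]) auto
      then show False using r by simp
    qed
  qed
  have seg_poly: False
    if ij: "i \<in> I" "j \<in> I" "v \<in> V" and q: "q \<noteq> v" "C i = closed_segment v q" "\<not> blocked v q"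
      and P: "aff_dim (C j) = 2" "v \<in> vertex_set (C j)"
        "\<forall>k\<in>I. \<forall>q. q \<noteq> v \<longrightarrow> C k = closed_segment v q \<longrightarrow> (\<forall>x\<in>C j - {v}. orient v q x < 0)"
    for i j v q
  proof -
    \<comment> \<open>The polygon itself blocks the segment at \<open>v\<close>.\<close>
    have "v \<in> C j" using P(2) vertex_set_subset(2)[OF ij(2)] by blast
    moreover have "\<forall>x\<in>C j - {v}. orient v q x < 0" using P(3) ij(1) q(1,2) by blast
    ultimately show False using q(3) not_single ij unfolding blocked_def by blast
  qed
  have "inj_on f I"
  proof (rule inj_onI, rule ccontr)
    fix i j assume ij: "i \<in> I" "j \<in> I" "f i = f j" "i \<noteq> j"
    note owners = f(2)[OF ij(1)] f(2)[OF ij(2), folded ij(3)] and V = f(1)[OF ij(1)]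
    \<comment> \<open>Only the case of two polygons uses the disjointness of vertex sets.\<close>
    from owners show False
      unfolding owns_def
    proof (elim disjE exE conjE)
    qed (use seg_seg[OF ij(1,2,4) V] seg_poly[OF ij(1,2) V] seg_poly[OF ij(2,1) V]
        polygons[OF ij(1,2,4)] in blast)+
  qed
  moreover have "f ` I \<subseteq> V" using f(1) by blast
  ultimately show ?thesis using finite_V by (rule card_inj_on_le)
qed

end

theorem theorem4p3:
  fixes W V :: "(real^2) set" and C :: "nat \<Rightarrow> (real^2) set" and m n :: nat
  assumes "finite W" and "V \<subseteq> W" and "card V = n" and "n \<ge> 1"
    and "\<And>i. i \<in> {1..m} \<Longrightarrow> \<exists>S. S \<subseteq> V \<and> C i = convex hull S"
    and "inj_on C {1..m}"
    and "\<And>i j. i \<in> {1..m} \<Longrightarrow> j \<in> {1..m} \<Longrightarrow> i \<noteq> j \<Longrightarrow> card (C i \<inter> C j \<inter> W) = 1"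
    and "\<And>i j. i \<in> {1..m} \<Longrightarrow> j \<in> {1..m} \<Longrightarrow> i \<noteq> j \<Longrightarrow> aff_dim (C i) = 2 \<Longrightarrow> aff_dim (C j) = 2
           \<Longrightarrow> vertex_set (C i) \<inter> vertex_set (C j) = {}"
  shows "m \<le> n"
proof (cases "m \<le> 1")
  \<comment> \<open>A single hull may be empty, as \<open>S = {}\<close> is allowed, so the locale
    is entered only for two or more hulls.\<close>
  case True
  then show ?thesis using assms(4) by simp
next
  case False
  interpret one_point_hulls W V C "{1..m}"
  proof
    fix i assume i: "i \<in> {1..m}"
    \<comment> \<open>Any second index will do: meeting another hull forces \<open>C i\<close> to be
      nonempty.\<close>
    define j :: nat where "j = (if i = 1 then 2 else 1)"
    have "card (C i \<inter> C j \<inter> W) = 1"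
      using i False by (intro assms(7)) (auto simp: j_def)
    then show "C i \<noteq> {}" by auto
  qed (use assms in auto)
  show ?thesis using card_le assms(3) by simp
qed

end
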